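(* For every $\epsilon>0$, there is a variable-length (deterministic) protocol for message exchange in the adaptive feedback model over a ternary alphabet that is resilient to a $\frac12-\epsilon$ fraction of errors.
   Context: Message exchange: Alice holds $x\in\{0,1\}^n$, Bob holds $y\in\{0,1\}^n$, and the goal is that both parties output $(x,y)$. Adaptive feedback model: in each round a single party sends one symbol of an alphabet $\Sigma$ to the other party, and the sender learns what the other party actually received, so both parties share the transcript $T$ of received symbols. The speaker of each round is a function of $T$, and the (common) decision to terminate is a function of $T$. The adversary may corrupt any transmitted symbol. The protocol is resilient to an $\alpha$ fraction of errors if for all $x,y$ and all adversarial attacks in which the parties terminate at round $R$, if the number of corrupted rounds is at most $\alpha R$ then both parties output $(x,y)$. Here $|\Sigma|=3$. *)

theory Defs
  imports Complex_Main
begin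

datatype party = Alice | Bob

text \<open>
  A deterministic protocol over the alphabet \<^typ>\<open>'s\<close>. Transcripts are the lists of received
  symbols, oldest first. A party's message and output may depend only on its own input and on the
  transcript. Since the sender learns what was received, the transcript is common knowledge; the
  speaker of the next round and the decision to terminate depend on the transcript alone.
\<close>

record 's protocol =
  speaker :: "'s list \<Rightarrow> party"
  stop :: "'s list \<Rightarrow> bool"
  message :: "party \<Rightarrow> bool list \<Rightarrow> 's list \<Rightarrow> 's"
  decision :: "party \<Rightarrow> bool list \<Rightarrow> 's list \<Rightarrow> bool list \<times> bool list"

fun input_of :: "bool list \<Rightarrow> bool list \<Rightarrow> party \<Rightarrow> bool list" where
  "input_of x y Alice = x"
| "input_of x y Bob = y"

definition sent :: "'s protocol \<Rightarrow> bool list \<Rightarrow> bool list \<Rightarrow> 's list \<Rightarrow> 's" where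
  "sent P x y T = message P (speaker P T) (input_of x y (speaker P T)) T"

text \<open>
  An attack maps the transcript so far and the symbol being sent to the symbol that is received.
  Attacks are always quantified after the protocol and both inputs, so the adversary may depend on
  all of these. The transcript is defined for every number of rounds, ignoring termination; only
  its values up to the round of termination are meaningful.
\<close>

type_synonym 's attack = "'s list \<Rightarrow> 's \<Rightarrow> 's"

fun transcript :: "'s protocol \<Rightarrow> bool list \<Rightarrow> bool list \<Rightarrow> 's attack \<Rightarrow> nat \<Rightarrow> 's list" where
  "transcript P x y adv 0 = []"
| "transcript P x y adv (Suc r) =
     (let T = transcript P x y adv r in T @ [adv T (sent P x y T)])"

definition terminates_at ::
    "'s protocol \<Rightarrow> bool list \<Rightarrow> bool list \<Rightarrow> 's attack \<Rightarrow> nat \<Rightarrow> bool" where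
  "terminates_at P x y adv R \<longleftrightarrow>
     stop P (transcript P x y adv R) \<and> (\<forall>r<R. \<not> stop P (transcript P x y adv r))"

definition corruptions ::
    "'s protocol \<Rightarrow> bool list \<Rightarrow> bool list \<Rightarrow> 's attack \<Rightarrow> nat \<Rightarrow> nat" where
  "corruptions P x y adv R =
     card {r. r < R \<and> (let T = transcript P x y adv r; s = sent P x y T in adv T s \<noteq> s)}"

text \<open>
  Resilience only constrains executions that terminate, so a protocol that never stops would be
  vacuously resilient. A variable-length protocol is therefore required to stop after finitely many
  rounds on all inputs of length \<open>n\<close> and under every attack, whatever its number of corruptions.
\<close>

definition variable_length_protocol :: "nat \<Rightarrow> 's protocol \<Rightarrow> bool" where
  "variable_length_protocol n P \<longleftrightarrow>
     (\<forall>x y adv. length x = n \<longrightarrow> length y = n \<longrightarrow> (\<exists>R. terminates_at P x y adv R))"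

definition resilient_message_exchange :: "nat \<Rightarrow> real \<Rightarrow> 's protocol \<Rightarrow> bool" where
  "resilient_message_exchange n \<alpha> P \<longleftrightarrow>
     (\<forall>x y adv R. length x = n \<longrightarrow> length y = n \<longrightarrow> terminates_at P x y adv R \<longrightarrow>
        real (corruptions P x y adv R) \<le> \<alpha> * real R \<longrightarrow>
        (\<forall>p. decision P p (input_of x y p) (transcript P x y adv R) = (x, y)))"

end

theory Submission
  imports Defs
begin

text \<open>
  The symbols mean ``append 0'', ``append 1'' and ``rewind''. First Alice and then Bob drives a walk
  in the binary tree: the speaker extends the walk towards the own input, padded with infinitely
  many zeros, or rewinds if the walk has left the correct path. A phase ends as soon as its walk has
  depth \<open>D\<close>. The potential of a walk is its correct minus its incorrect length. An uncorrupted round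
  adds 1 to it and a corrupted round subtracts at most 1, so the sum of both potentials is at least
  the number of rounds minus twice the number of corruptions. If an input of length \<open>n\<close> is decoded
  wrongly, the potential of its walk is at most \<open>2n - D\<close> and the sum is at most \<open>2n\<close>, which is a
  negligible part of the at least \<open>2D\<close> rounds. If the adversary stalls the walks, the protocol
  gives up after a number of rounds that makes the maximal sum \<open>2D\<close> negligible.
\<close>

text \<open>Walks are stacks, with the most recent bit at the head.\<close>

fun on_path :: "(nat \<Rightarrow> bool) \<Rightarrow> bool list \<Rightarrow> bool" where
  "on_path f [] \<longleftrightarrow> True"
| "on_path f (b # w) \<longleftrightarrow> b = f (length w) \<and> on_path f w"

text \<open>Every bit after the first deviation counts as incorrect, even one that agrees with
  \<open>f\<close>.\<close>

fun potential :: "(nat \<Rightarrow> bool) \<Rightarrow> bool list \<Rightarrow> int" where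
  "potential f [] = 0"
| "potential f (b # w) = (if on_path f (b # w) then int (length w) + 1 else potential f w - 1)"

definition padded :: "bool list \<Rightarrow> nat \<Rightarrow> bool" where
  "padded x i \<longleftrightarrow> i < length x \<and> x ! i"

lemma potential_on_path: "on_path f w \<Longrightarrow> potential f w = int (length w)"
  by (cases w) auto

lemma potential_le_length: "potential f w \<le> int (length w)"
  by (induction w) auto

lemma on_path_rev_nth: "on_path f w \<Longrightarrow> i < length w \<Longrightarrow> rev w ! i = f i"
  by (induction w) (auto simp: nth_append less_Suc_eq)

lemma on_path_decode:
  assumes "on_path (padded x) w" "length x \<le> length w"
  shows "take (length x) (rev w) = x"
  using assms by (intro nth_equalityI) (auto simp: on_path_rev_nth padded_def)

text \<open>A wrong decoding puts the first deviation among the first \<open>length x\<close> bits;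
  every later bit then costs 1.\<close>

lemma potential_wrong:
  assumes "length x \<le> length w" "take (length x) (rev w) \<noteq> x"
  shows "potential (padded x) w \<le> 2 * int (length x) - int (length w)"
  using assms
proof (induction w)
  case Nil
  then show ?case by simp
next
  case (Cons b w)
  have off: "\<not> on_path (padded x) (b # w)"
    using on_path_decode Cons.prems by blast
  show ?case
  proof (cases "length x \<le> length w")
    case True
    then show ?thesis using Cons off by simp
  next
    \<comment> \<open>Now \<open>b\<close> is the last decoded bit, so bounding the potential of
      \<open>w\<close> by its length is enough.\<close>
    case False
    then show ?thesis
      using potential_le_length[of "padded x" w] Cons.prems(1) off by auto
  qed
qed

lemma length_transcript [simp]: "length (transcript P x y adv r) = r"
  by (induction r) (auto simp: Let_def)

lemma corruptions_0 [simp]: "corruptions P x y adv 0 = 0"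
  by (simp add: corruptions_def)

lemma corruptions_Suc:
  "corruptions P x y adv (Suc r) = corruptions P x y adv r +
     (let T = transcript P x y adv r; s = sent P x y T in if adv T s \<noteq> s then 1 else 0)"
proof -
  define Q where
    "Q r \<longleftrightarrow> (let T = transcript P x y adv r; s = sent P x y T in adv T s \<noteq> s)" for r
  have "{k. k < Suc r \<and> Q k} = (if Q r then insert r {k. k < r \<and> Q k} else {k. k < r \<and> Q k})"
    by (auto simp: less_Suc_eq)
  then have "card {k. k < Suc r \<and> Q k} = card {k. k < r \<and> Q k} + (if Q r then 1 else 0)"
    by simp
  then show ?thesis
    by (simp add: corruptions_def Q_def Let_def)
qed

text \<open>\<open>D\<close> is the depth that ends a phase, \<open>L\<close> the round limit and
  \<open>n\<close> the input length.\<close>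

locale rewind_walks =
  fixes zero one rewind :: 's and D L n :: nat
  assumes distinct: "zero \<noteq> one" "rewind \<noteq> zero" "rewind \<noteq> one"
    and depth_pos: "0 < D"
begin

definition move :: "'s \<Rightarrow> bool list \<Rightarrow> bool list" where
  "move s w = (if s = zero then False # w else if s = one then True # w else tl w)"

definition instruction :: "(nat \<Rightarrow> bool) \<Rightarrow> bool list \<Rightarrow> 's" where
  "instruction f w = (if on_path f w then if f (length w) then one else zero else rewind)"

text \<open>On the path the instruction adds a correct bit; off it, the walk is nonempty and the
  rewind removes an incorrect bit.\<close>

lemma potential_instruction: "potential f (move (instruction f w) w) = potential f w + 1"
  using distinct
  by (cases w) (auto simp: move_def instruction_def potential_on_path)

lemma potential_move: "potential f w - 1 \<le> potential f (move s w)"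
  by (cases w) (auto simp: move_def potential_on_path)

lemma length_move: "length (move s w) \<le> Suc (length w)"
  by (auto simp: move_def)

definition step :: "bool list \<times> bool list \<Rightarrow> 's \<Rightarrow> bool list \<times> bool list" where
  "step = (\<lambda>(u, v) s. if length u < D then (move s u, v) else (u, move s v))"

definition walks :: "'s list \<Rightarrow> bool list \<times> bool list" where
  "walks T = foldl step ([], []) T"

text \<open>The decision is read off the shared transcript, so the two parties always agree.\<close>

definition rewind_protocol :: "'s protocol" where
  "rewind_protocol =
     \<lparr>speaker = \<lambda>T. if length (fst (walks T)) < D then Alice else Bob,
      stop = \<lambda>T. length (snd (walks T)) = D \<or> length T = L,
      message = \<lambda>p x T. instruction (padded x) (case p of Alice \<Rightarrow> fst (walks T) | Bob \<Rightarrow> snd (walks T)),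
      decision = \<lambda>p x T. (take n (rev (fst (walks T))), take n (rev (snd (walks T))))\<rparr>"

lemma walks_Nil [simp]: "walks [] = ([], [])"
  by (simp add: walks_def)

lemma walks_snoc [simp]: "walks (T @ [s]) = step (walks T) s"
  by (simp add: walks_def)

lemma walks_lengths:
  assumes "walks T = (u, v)"
  shows "length u \<le> D" "v \<noteq> [] \<Longrightarrow> length u = D" "length u + length v \<le> length T"
proof -
  have "length u \<le> D \<and> (v \<noteq> [] \<longrightarrow> length u = D) \<and> length u + length v \<le> length T"
    using assms
  proof (induction T arbitrary: u v rule: rev_induct)
    case Nil
    then show ?case by simp
  next
    case (snoc s T)
    obtain u' v' where "walks T = (u', v')" by fastforce
    with snoc show ?case
      using length_move[of s u'] length_move[of s v']
      by (fastforce simp: step_def split: if_splits)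
  qed
  then show "length u \<le> D" "v \<noteq> [] \<Longrightarrow> length u = D" "length u + length v \<le> length T"
    by auto
qed

text \<open>\<open>step\<close> freezes the first walk at depth \<open>D\<close>, but the second
  only stays within \<open>D\<close> because the protocol stops when it gets there.\<close>

lemma walks_snd_le:
  assumes "\<And>k. k < r \<Longrightarrow> \<not> stop rewind_protocol (transcript rewind_protocol x y adv k)"
  shows "length (snd (walks (transcript rewind_protocol x y adv r))) \<le> D"
  using assms
proof (induction r)
  case 0
  then show ?case by simp
next
  case (Suc r)
  let ?T = "transcript rewind_protocol x y adv r"
  obtain u v where uv: "walks ?T = (u, v)" by fastforce
  have "length v \<le> D" "length v \<noteq> D"
    using Suc.IH Suc.prems[of r] Suc.prems uv by (auto simp: rewind_protocol_def)
  then show ?case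
    using uv length_move[of "adv ?T (sent rewind_protocol x y ?T)" v]
    by (auto simp: Let_def step_def)
qed

lemma potential_bound:
  assumes "walks (transcript rewind_protocol x y adv r) = (u, v)"
  shows "int r - 2 * int (corruptions rewind_protocol x y adv r)
           \<le> potential (padded x) u + potential (padded y) v"
  using assms
proof (induction r arbitrary: u v)
  case 0
  then show ?case by simp
next
  case (Suc r)
  let ?T = "transcript rewind_protocol x y adv r"
  let ?s = "sent rewind_protocol x y ?T"
  let ?a = "adv ?T ?s"
  obtain u' v' where uv': "walks ?T = (u', v')" by fastforce
  have sent: "?s = (if length u' < D then instruction (padded x) u' else instruction (padded y) v')"
    using uv' by (simp add: sent_def rewind_protocol_def)
  have uv: "(u, v) = (if length u' < D then (move ?a u', v') else (u', move ?a v'))"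
    using Suc.prems uv' by (simp add: Let_def step_def)
  have "potential (padded x) u' + potential (padded y) v' + (if ?a \<noteq> ?s then -1 else 1)
          \<le> potential (padded x) u + potential (padded y) v"
    using uv sent potential_move[of "padded x" u' ?a] potential_move[of "padded y" v' ?a]
      potential_instruction[of "padded x" u'] potential_instruction[of "padded y" v']
    by (auto split: if_splits)
  with Suc.IH[OF uv'] show ?case
    by (auto simp: corruptions_Suc Let_def split: if_splits)
qed

lemma variable_length: "variable_length_protocol n rewind_protocol"
  unfolding variable_length_protocol_def
proof (intro allI impI)
  fix x y adv
  let ?stops = "\<lambda>r. stop rewind_protocol (transcript rewind_protocol x y adv r)"
  have "?stops L"
    by (simp add: rewind_protocol_def)
  then have "?stops (Least ?stops)"
    by (rule LeastI)
  then show "\<exists>R. terminates_at rewind_protocol x y adv R"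
    unfolding terminates_at_def using not_less_Least by blast
qed

lemma resilient:
  assumes "n \<le> D" and eps: "0 < \<epsilon>" "real n < 2 * \<epsilon> * real D" "real D < \<epsilon> * real L"
  shows "resilient_message_exchange n (1/2 - \<epsilon>) rewind_protocol"
  unfolding resilient_message_exchange_def
proof (intro allI impI)
  fix x y adv R p
  assume len: "length x = n" "length y = n"
    and terminates: "terminates_at rewind_protocol x y adv R"
    and few: "real (corruptions rewind_protocol x y adv R) \<le> (1/2 - \<epsilon>) * real R"
  let ?T = "transcript rewind_protocol x y adv R"
  obtain u v where uv: "walks ?T = (u, v)" by fastforce
  note lengths = walks_lengths[OF uv]
  have "length v \<le> D"
    using walks_snd_le[of R x y adv] terminates uv by (auto simp: terminates_at_def)
  have "real_of_int (int R - 2 * int (corruptions rewind_protocol x y adv R))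
          \<le> real_of_int (potential (padded x) u + potential (padded y) v)"
    using potential_bound[OF uv] by (simp only: of_int_le_iff)
  \<comment> \<open>The allowed corruptions leave
    \<open>R - 2 * (1/2 - \<epsilon>) * R = 2 * \<epsilon> * R\<close>.\<close>
  with few have pot:
    "2 * (\<epsilon> * real R) \<le> real_of_int (potential (padded x) u + potential (padded y) v)"
    by (simp add: algebra_simps)
  \<comment> \<open>At the round limit the sum would be at least \<open>2 * \<epsilon> * L\<close>,
    which exceeds its maximum \<open>2 * D\<close>.\<close>
  have "R \<noteq> L"
  proof
    assume "R = L"
    have "potential (padded x) u + potential (padded y) v \<le> 2 * int D"
      using potential_le_length[of "padded x" u] potential_le_length[of "padded y" v]
        lengths(1) \<open>length v \<le> D\<close> by linarith
    then have "real_of_int (potential (padded x) u + potential (padded y) v) \<le> 2 * real D"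
      by linarith
    with pot eps(3) \<open>R = L\<close> show False by simp
  qed
  with terminates uv have "length v = D"
    by (simp add: terminates_at_def rewind_protocol_def)
  \<comment> \<open>As \<open>D\<close> is positive, \<open>v\<close> is nonempty, so the first
    phase is complete.\<close>
  with lengths(2) depth_pos have "length u = D" by fastforce
  have "take n (rev u) = x \<and> take n (rev v) = y"
  proof (rule ccontr)
    assume "\<not> (take n (rev u) = x \<and> take n (rev v) = y)"
    then have "potential (padded x) u \<le> 2 * int n - int D
        \<or> potential (padded y) v \<le> 2 * int n - int D"
      using potential_wrong[of x u] potential_wrong[of y v] len \<open>n \<le> D\<close>
        \<open>length u = D\<close> \<open>length v = D\<close> by auto
    \<comment> \<open>The other walk contributes at most \<open>D\<close>, which cancels the
      \<open>- D\<close> of the wrong one.\<close>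
    then have "potential (padded x) u + potential (padded y) v \<le> 2 * int n"
      using potential_le_length[of "padded x" u] potential_le_length[of "padded y" v]
        \<open>length u = D\<close> \<open>length v = D\<close> by linarith
    then have "real_of_int (potential (padded x) u + potential (padded y) v) \<le> 2 * real n"
      by linarith
    with pot have "\<epsilon> * real R \<le> real n" by simp
    \<comment> \<open>Two walks of depth \<open>D\<close> take at least \<open>2 * D\<close>
      rounds.\<close>
    moreover have "\<epsilon> * real (2 * D) \<le> \<epsilon> * real R"
      using lengths(3) \<open>length u = D\<close> \<open>length v = D\<close> eps(1)
      by (intro mult_left_mono) auto
    ultimately show False using eps(2) by simp
  qed
  then show "decision rewind_protocol p (input_of x y p) ?T = (x, y)"
    using uv by (simp add: rewind_protocol_def)
qed

end

theorem theorem1p4: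
  fixes \<epsilon> :: real and n :: nat
  assumes "\<epsilon> > 0"
    and "card (UNIV :: 's set) = 3"
  shows "\<exists>P :: 's protocol.
           variable_length_protocol n P \<and> resilient_message_exchange n (1/2 - \<epsilon>) P"
proof -
  obtain zero one rewind :: 's where distinct: "zero \<noteq> one" "rewind \<noteq> zero" "rewind \<noteq> one"
    using assms(2) by (auto simp: card_3_iff)
  obtain d :: nat where "real n / (2 * \<epsilon>) < real d"
    using reals_Archimedean2 by blast
  then have d: "real n < 2 * \<epsilon> * real d"
    using assms(1) by (simp add: field_simps)
  \<comment> \<open>The summand \<open>n\<close> ensures \<open>n \<le> D\<close>, and the 1 ensures
    \<open>0 < D\<close>.\<close>
  define D where "D = d + n + 1"
  have D: "real n < 2 * \<epsilon> * real D"
    by (rule less_le_trans[OF d]) (use assms(1) in \<open>simp add: D_def\<close>)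
  obtain L :: nat where "real D / \<epsilon> < real L"
    using reals_Archimedean2 by blast
  then have L: "real D < \<epsilon> * real L"
    using assms(1) by (simp add: field_simps)
  interpret rewind_walks zero one rewind D L n
    by unfold_locales (use distinct in \<open>auto simp: D_def\<close>)
  have "resilient_message_exchange n (1/2 - \<epsilon>) rewind_protocol"
    by (rule resilient) (use assms(1) D L in \<open>auto simp: D_def\<close>)
  with variable_length show ?thesis by blast
qed

end
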